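(* Let $a$ and $b$ be fixed real numbers with $a\ge 2b$ and $0\le b<2$. Then there exists a constant $C=C(a,b)>0$, depending only on $a$ and $b$, such that for every sequence $x_1,x_2,\ldots$ of real numbers and every integer $N\ge 1$, $$ D(N,x_n)\le C\left(\sum_{h=1}^{\infty}h^{-\frac{2+a-2b}{2-b}}\left(\frac{1}{N}\left|\sum_{n=1}^N e^{2\pi i h x_n}\right|\right)^{\frac{2}{2-b}}\right)^{\frac{2-b}{2+a-b}}. $$
   Context: For a real number $x$, $\{x\}$ denotes its fractional part. For a sequence $x_1,x_2,\ldots$ of real numbers, an integer $N\ge 1$ and real numbers $0\le\alpha<\beta\le 1$, $F(N,x_n;\alpha,\beta)$ denotes the number of indices $n$ with $1\le n\le N$ such that $\alpha\le\{x_n\}<\beta$. The quantity $D(N,x_n)$ is defined by $$ D(N,x_n)=\sup_{0\le\alpha<\beta\le 1}\left|\frac{F(N,x_n;\alpha,\beta)}{N}-(\beta-\alpha)\right|. $$ The infinite series on the right-hand side has nonnegative terms and its sum is understood in $[0,+\infty]$ (if it diverges, the right-hand side is $+\infty$). *)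

theory Defs
  imports "HOL-Analysis.Analysis"
begin

text \<open>
  A sequence \<open>x\<^sub>1, x\<^sub>2, \<dots>\<close> is a function \<open>x :: nat \<Rightarrow> real\<close>; the value \<open>x 0\<close> is never used.
\<close>

definition count_frac :: "nat \<Rightarrow> (nat \<Rightarrow> real) \<Rightarrow> real \<Rightarrow> real \<Rightarrow> nat" where
  "count_frac N x \<alpha> \<beta> = card {n \<in> {1..N}. \<alpha> \<le> frac (x n) \<and> frac (x n) < \<beta>}"

text \<open>
  For \<open>N \<ge> 1\<close> the supremum below is over a nonempty set that is bounded above (by 1), so
  the supremum operator on the reals is the true one.
\<close>

definition discrepancy :: "nat \<Rightarrow> (nat \<Rightarrow> real) \<Rightarrow> real" where
  "discrepancy N x =
     (SUP (\<alpha>, \<beta>) \<in> {(\<alpha>, \<beta>). 0 \<le> \<alpha> \<and> \<alpha> < \<beta> \<and> \<beta> \<le> 1}.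
        \<bar>real (count_frac N x \<alpha> \<beta>) / real N - (\<beta> - \<alpha>)\<bar>)"

text \<open>
  The power function on \<open>[0, \<infinity>]\<close>, meant for exponents \<open>p > 0\<close> only.
\<close>

definition ennreal_powr :: "ennreal \<Rightarrow> real \<Rightarrow> ennreal" where
  "ennreal_powr t p = (if t = \<infinity> then \<infinity> else ennreal (enn2real t powr p))"

end

theory Submission
  imports Defs
begin

text \<open>
  Write \<open>c\<^sub>h\<close> for \<open>1/N\<close> times the modulus of the \<open>h\<close>-th exponential sum, and \<open>\<Phi>(t)\<close> for the mean of
  \<open>frac (x\<^sub>n - t) - 1/2\<close>. The local discrepancy of \<open>[\<alpha>, \<beta>)\<close> is \<open>\<Phi>(\<beta>) - \<Phi>(\<alpha>)\<close>. Since \<open>\<Phi>\<close> decreases with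
  slope at most \<open>1\<close>, a value of \<open>\<bar>\<Phi>\<bar>\<close> near its supremum persists on an interval of length comparable
  to \<open>1/H\<close>, hence survives averaging against the Fejer kernel of order \<open>H\<close>; the average is a sine
  polynomial bounded by the \<open>c\<^sub>h\<close>. This gives the Erdos--Turan inequality
  \<open>D \<le> 8/H + 4 (\<Sum>h\<le>H. c\<^sub>h/h)\<close>.

  Terms with \<open>c\<^sub>h \<le> h/H\<^sup>2\<close> contribute at most \<open>1/H\<close> to the sum; the others satisfy
  \<open>c\<^sub>h/h \<le> h\<^sup>-\<^sup>s c\<^sub>h\<^sup>p H\<^sup>\<kappa>\<close> with \<open>p = 2/(2-b)\<close>, \<open>s = (2+a-2b)/(2-b)\<close>, \<open>\<kappa> = a/(2-b)\<close>, because \<open>a \<ge> 2b\<close>.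
  If \<open>T\<close> is the sum of the series, choosing \<open>H\<close> as the integer part of \<open>T\<close> to the power
  \<open>-1/(1+\<kappa>) = -(2-b)/(2+a-b)\<close> balances the two contributions.
\<close>

section \<open>The Fejer kernel in closed form\<close>

lemma dirichlet_kernel_identity:
  fixes z :: real
  shows "sin z * (1 + 2 * (\<Sum>h=1..n. cos (2 * real h * z))) = sin ((2 * real n + 1) * z)"
proof (induction n)
  case (Suc n)
  have "sin ((2 * real (Suc n) + 1) * z) - sin ((2 * real n + 1) * z)
      = 2 * sin z * cos (2 * real (Suc n) * z)"
    using sin_add[of "2 * real (Suc n) * z" z] sin_diff[of "2 * real (Suc n) * z" z]
    by (simp add: algebra_simps)
  with Suc show ?case by (simp add: algebra_simps)
qed simp

text \<open>Raising \<open>n\<close> by one adds a Dirichlet kernel on the left and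
  \<open>sin z * sin ((2 * n + 1) * z)\<close> on the right, so the Dirichlet identities add up. The
  product form avoids a division where \<open>sin z\<close> vanishes.\<close>

lemma fejer_kernel_identity:
  fixes z :: real
  shows "(sin z)\<^sup>2 * (real n + 2 * (\<Sum>h=1..n. (real n - real h) * cos (2 * real h * z)))
    = (sin (real n * z))\<^sup>2"
proof (induction n)
  case (Suc n)
  have "(\<Sum>h=1..Suc n. (real (Suc n) - real h) * cos (2 * real h * z))
      = (\<Sum>h=1..n. (real n - real h) * cos (2 * real h * z)) + (\<Sum>h=1..n. cos (2 * real h * z))"
    by (simp add: algebra_simps flip: sum.distrib)
  moreover have "(sin (real (Suc n) * z))\<^sup>2 - (sin (real n * z))\<^sup>2 = sin z * sin ((2 * real n + 1) * z)"
  proof -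
    have *: "(sin (u + z))\<^sup>2 - (sin u)\<^sup>2 = sin z * sin (u + (u + z))" for u
    proof -
      have "(sin u)\<^sup>2 + (cos u)\<^sup>2 = 1" "(sin z)\<^sup>2 + (cos z)\<^sup>2 = 1" by auto
      then show ?thesis unfolding sin_add cos_add by algebra
    qed
    show ?thesis using *[of "real n * z"] by (simp add: algebra_simps)
  qed
  ultimately show ?case
    using Suc dirichlet_kernel_identity[of z n] by (simp add: power2_eq_square algebra_simps) algebra
qed simp

definition fejer :: "nat \<Rightarrow> real \<Rightarrow> real" where
  "fejer H y = 1 + 2 * (\<Sum>h=1..H. (1 - real h / real H) * cos (2 * pi * real h * y))"

lemma fejer_sin:
  assumes "H \<ge> 1"
  shows "real H * (sin (pi * y))\<^sup>2 * fejer H y = (sin (real H * (pi * y)))\<^sup>2"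
proof -
  have "real H * fejer H y
      = real H + 2 * (\<Sum>h=1..H. (real H - real h) * cos (2 * real h * (pi * y)))"
    using assms by (simp add: fejer_def sum_distrib_left algebra_simps)
  then show ?thesis
    using fejer_kernel_identity[of "pi * y" H] by (metis mult.assoc mult.commute)
qed

lemma sin_pi_pos: "0 < y \<Longrightarrow> y < 1 \<Longrightarrow> 0 < sin (pi * y)"
  by (simp add: sin_gt_zero)

lemma fejer_le:
  assumes "H \<ge> 1" "0 < y" "y < 1"
  shows "fejer H y \<le> 1 / (real H * (sin (pi * y))\<^sup>2)"
proof -
  have "real H * (sin (pi * y))\<^sup>2 * fejer H y \<le> 1"
    using fejer_sin[OF assms(1), of y] by (simp add: abs_square_le_1)
  moreover have "0 < real H * (sin (pi * y))\<^sup>2"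
    using sin_pi_pos[OF assms(2,3)] assms(1) by simp
  ultimately show ?thesis by (simp add: pos_le_divide_eq mult.commute)
qed

text \<open>Inside the interval the closed form is a square divided by a positive factor. That
  factor vanishes at 0 and 1, but there all cosines equal 1 and the coefficients are
  nonnegative.\<close>

lemma fejer_nonneg:
  assumes "H \<ge> 1" "0 \<le> y" "y \<le> 1"
  shows "0 \<le> fejer H y"
proof (cases "y = 0 \<or> y = 1")
  case True
  then have "cos (2 * pi * real h * y) = 1" for h
    using cos_int_2pin[of "int h"] by (auto simp: mult_ac)
  then show ?thesis
    using assms by (auto simp: fejer_def intro!: add_nonneg_nonneg sum_nonneg)
next
  case False
  then have "0 < real H * (sin (pi * y))\<^sup>2"
    using sin_pi_pos[of y] assms by simp
  then show ?thesis
    using fejer_sin[OF assms(1), of y] by (metis zero_le_mult_iff zero_le_power2 not_le)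
qed

section \<open>Antiderivatives of the kernel\<close>

definition fejer_prim :: "nat \<Rightarrow> real \<Rightarrow> real" where
  "fejer_prim H y = y + (\<Sum>h=1..H. (1 - real h / real H) * sin (2 * pi * real h * y) / (pi * real h))"

text \<open>A second antiderivative, needed to integrate the kernel against linear functions. Its
  additive constant is arbitrary, as only differences occur.\<close>

definition fejer_prim2 :: "nat \<Rightarrow> real \<Rightarrow> real" where
  "fejer_prim2 H y = y\<^sup>2 / 2
     - (\<Sum>h=1..H. (1 - real h / real H) * cos (2 * pi * real h * y) / (2 * (pi * real h)\<^sup>2))"

lemma DERIV_fejer_prim: "(fejer_prim H has_real_derivative fejer H y) (at y within A)"
  unfolding fejer_prim_def [abs_def] fejer_def sum_distrib_left
  by (auto intro!: derivative_eq_intros sum.cong simp: field_simps)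

lemma DERIV_fejer_prim2: "(fejer_prim2 H has_real_derivative fejer_prim H y) (at y within A)"
proof -
  have "((\<lambda>y. (1 - real h / real H) * cos (2 * pi * real h * y) / (2 * (pi * real h)\<^sup>2))
      has_real_derivative - ((1 - real h / real H) * sin (2 * pi * real h * y) / (pi * real h)))
      (at y within A)" if "h \<in> {1..H}" for h
    using that by (auto intro!: derivative_eq_intros simp: field_simps power2_eq_square)
  then have sums: "((\<lambda>y. \<Sum>h=1..H. (1 - real h / real H) * cos (2 * pi * real h * y) / (2 * (pi * real h)\<^sup>2))
      has_real_derivative (\<Sum>h=1..H. - ((1 - real h / real H) * sin (2 * pi * real h * y) / (pi * real h))))
      (at y within A)"
    by (rule DERIV_sum)
  have "((\<lambda>y. y\<^sup>2 / 2) has_real_derivative y) (at y within A)"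
    by (auto intro!: derivative_eq_intros)
  from DERIV_diff[OF this sums] show ?thesis
    by (simp only: fejer_prim2_def [abs_def] fejer_prim_def sum_negf diff_minus_eq_add)
qed

lemma fejer_prim_0_1: "fejer_prim H 0 = 0" "fejer_prim H 1 = 1"
proof -
  have "sin (2 * pi * real h) = 0" for h
    using sin_int_2pin[of "int h"] by simp
  then show "fejer_prim H 0 = 0" "fejer_prim H 1 = 1" by (simp_all add: fejer_prim_def)
qed

lemma fejer_prim2_diff: "fejer_prim2 H 1 - fejer_prim2 H 0 = 1 / 2"
proof -
  have "cos (2 * pi * real h) = 1" for h
    using cos_int_2pin[of "int h"] by simp
  then show ?thesis by (simp add: fejer_prim2_def)
qed

lemma fejer_integral: "(fejer H has_integral 1) {0..1}"
  using fundamental_theorem_of_calculus[of 0 1 "fejer_prim H" "fejer H"] DERIV_fejer_prim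
  by (simp add: has_real_derivative_iff_has_vector_derivative fejer_prim_0_1)

section \<open>The sawtooth function and its Fejer mean\<close>

definition saw :: "real \<Rightarrow> real" where
  "saw t = frac t - 1 / 2"

lemma saw_add_int: "saw (t + of_int k) = saw t"
  by (simp add: saw_def frac_def)

lemma linear_fejer_integral:
  assumes "u \<le> v"
  shows "((\<lambda>y. (c - y) * fejer H y) has_integral
    ((c - v) * fejer_prim H v + fejer_prim2 H v - ((c - u) * fejer_prim H u + fejer_prim2 H u))) {u..v}"
  using assms
  by (intro fundamental_theorem_of_calculus)
    (auto simp: has_real_derivative_iff_has_vector_derivative[symmetric]
      intro!: derivative_eq_intros DERIV_fejer_prim DERIV_fejer_prim2)

text \<open>This is the Fourier series of \<open>saw\<close> with its h-th coefficient damped by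
  \<open>1 - h/H\<close>. With \<open>r = frac x\<close>, the function \<open>saw (r - y)\<close> is
  linear on both sides of \<open>y = r\<close>, so two integrals of linear functions against the
  kernel suffice.\<close>

lemma saw_fejer_integral:
  "((\<lambda>y. saw (x - y) * fejer H y) has_integral
    - (\<Sum>h=1..H. (1 - real h / real H) * sin (2 * pi * real h * x) / (pi * real h))) {0..1}"
proof -
  define r where "r = frac x"
  have r: "0 \<le> r" "r < 1" and x: "x = r + of_int \<lfloor>x\<rfloor>"
    by (auto simp: r_def frac_lt_1) (simp add: frac_def)
  have saw: "saw (x - y) = saw (r - y)" for y
    using saw_add_int[of "r - y" "\<lfloor>x\<rfloor>"] x by (simp add: algebra_simps)
  have sin: "sin (2 * pi * real h * x) = sin (2 * pi * real h * r)" for h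
  proof -
    have "2 * pi * real h * x = 2 * pi * real h * r + 2 * pi * of_int (int h * \<lfloor>x\<rfloor>)"
      by (subst x) (simp add: algebra_simps)
    then show ?thesis
      by (simp add: sin_add sin_int_2pin cos_int_2pin del: of_int_mult)
  qed
  have "((\<lambda>y. saw (r - y) * fejer H y) has_integral
      ((r - 1/2 - r) * fejer_prim H r + fejer_prim2 H r
        - ((r - 1/2 - 0) * fejer_prim H 0 + fejer_prim2 H 0))) {0..r}"
  proof (rule has_integral_eq[OF _ linear_fejer_integral])
    fix y assume "y \<in> {0..r}"
    then have "frac (r - y) = r - y" using r by (simp add: frac_eq)
    then show "(r - 1/2 - y) * fejer H y = saw (r - y) * fejer H y" by (simp add: saw_def)
  qed (use r in auto)
  moreover have "((\<lambda>y. saw (r - y) * fejer H y) has_integral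
      ((r + 1/2 - 1) * fejer_prim H 1 + fejer_prim2 H 1
        - ((r + 1/2 - r) * fejer_prim H r + fejer_prim2 H r))) {r..1}"
  \<comment> \<open>At \<open>y = r\<close> the sawtooth jumps and the linear formula fails, at this
    one point only.\<close>
  proof (rule has_integral_spike_finite[OF _ _ linear_fejer_integral])
    fix y assume "y \<in> {r..1} - {r}"
    then have "frac (r - y) = r - y + 1" using r by (auto simp: frac_unique_iff)
    then show "saw (r - y) * fejer H y = (r + 1/2 - y) * fejer H y" by (simp add: saw_def)
  qed (use r in auto)
  ultimately have "((\<lambda>y. saw (r - y) * fejer H y) has_integral (r - fejer_prim H r)) {0..1}"
  proof (rule has_integral_combine[OF r(1) less_imp_le[OF r(2)], THEN has_integral_eq_rhs])
  qed (use fejer_prim2_diff[of H] in \<open>simp add: fejer_prim_0_1 algebra_simps\<close>)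
  then show ?thesis
    by (simp add: saw sin fejer_prim_def)
qed

section \<open>Averaging against the kernel\<close>

lemma inverse_sin_square_integral:
  assumes "0 < \<delta>" "\<delta> \<le> 1 / 2"
  shows "((\<lambda>y. 1 / (sin (pi * y))\<^sup>2) has_integral 2 * cot (pi * \<delta>) / pi) {\<delta>..1 - \<delta>}"
proof -
  have "((\<lambda>y. 1 / (sin (pi * y))\<^sup>2) has_integral
      (- cot (pi * (1 - \<delta>)) / pi - (- cot (pi * \<delta>) / pi))) {\<delta>..1 - \<delta>}"
  proof (rule fundamental_theorem_of_calculus)
    fix y assume "y \<in> {\<delta>..1 - \<delta>}"
    then have "sin (pi * y) \<noteq> 0"
      using sin_pi_pos[of y] assms by auto
    then show "((\<lambda>y. - cot (pi * y) / pi) has_vector_derivative 1 / (sin (pi * y))\<^sup>2)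
        (at y within {\<delta>..1 - \<delta>})"
      unfolding has_real_derivative_iff_has_vector_derivative[symmetric]
      by (auto intro!: derivative_eq_intros DERIV_chain2[OF DERIV_cot] simp: field_simps)
  qed (use assms in auto)
  moreover have "cot (pi * (1 - \<delta>)) = - cot (pi * \<delta>)"
    by (simp add: cot_def algebra_simps sin_diff cos_diff)
  ultimately show ?thesis by simp
qed

text \<open>The kernel has mass 1, so a lower bound \<open>m\<close> everywhere would give
  \<open>m\<close>. On the middle part only \<open>- S\<close> is available; the loss there is at
  most \<open>2 * S\<close> times the kernel mass, which the bound \<open>1 / (H * sin^2)\<close>
  controls.\<close>

lemma fejer_average_ge:
  assumes H: "H \<ge> 1" and d: "0 < \<delta>" "\<delta> \<le> 1 / 2"
    and I: "((\<lambda>y. g y * fejer H y) has_integral I) {0..1}"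
    and bound: "\<And>y. - S \<le> g y" "m \<le> S"
    and near: "\<And>y. 0 \<le> y \<Longrightarrow> y \<le> \<delta> \<Longrightarrow> m \<le> g y" "\<And>y. 1 - \<delta> \<le> y \<Longrightarrow> y \<le> 1 \<Longrightarrow> m \<le> g y"
    and S: "0 \<le> m + S"
  shows "m - 2 * S * (2 * cot (pi * \<delta>) / pi / real H) \<le> I"
proof -
  define tail where "tail y = (if y \<in> {\<delta>..1 - \<delta>} then 1 / (sin (pi * y))\<^sup>2 else 0)" for y
  have "(tail has_integral 2 * cot (pi * \<delta>) / pi) {0..1}"
    using has_integral_restrict_closed_subinterval[of "\<lambda>y. 1 / (sin (pi * y))\<^sup>2" _ \<delta> "1 - \<delta>" 0 1]
      inverse_sin_square_integral[OF d] d by (simp add: tail_def [abs_def])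
  then have "((\<lambda>y. m * fejer H y - 2 * S * (tail y / real H)) has_integral
      m * 1 - 2 * S * (2 * cot (pi * \<delta>) / pi / real H)) {0..1}"
    by (intro has_integral_diff has_integral_mult_right has_integral_divide fejer_integral)
  then have "m * 1 - 2 * S * (2 * cot (pi * \<delta>) / pi / real H) \<le> I"
  proof (rule has_integral_le[OF _ I])
    fix y :: real assume y: "y \<in> {0..1}"
    have K: "0 \<le> fejer H y" using fejer_nonneg[OF H] y by simp
    have S0: "0 \<le> S" using bound S by linarith
    show "m * fejer H y - 2 * S * (tail y / real H) \<le> g y * fejer H y"
    proof (cases "y \<in> {\<delta>..1 - \<delta>}")
      case True
      then have "fejer H y \<le> tail y / real H"
        using fejer_le[OF H, of y] d by (simp add: tail_def mult.commute)
      then have "2 * S * fejer H y \<le> 2 * S * (tail y / real H)"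
        using S0 by (intro mult_left_mono) auto
      \<comment> \<open>From \<open>m \<le> S\<close> follows
        \<open>m - 2 * S \<le> - S \<le> g y\<close>.\<close>
      moreover have "(m - 2 * S) * fejer H y \<le> g y * fejer H y"
        using bound(1)[of y] bound(2) K by (intro mult_right_mono) auto
      ultimately show ?thesis by (simp add: algebra_simps)
    next
      case False
      then have "m \<le> g y" using near y by force
      then show ?thesis using False K by (auto simp: tail_def intro: mult_right_mono)
    qed
  qed
  then show ?thesis by simp
qed

section \<open>The mean sawtooth and the counting function\<close>

definition saw_mean :: "nat \<Rightarrow> (nat \<Rightarrow> real) \<Rightarrow> real \<Rightarrow> real" where
  "saw_mean N x t = (\<Sum>n=1..N. saw (x n - t)) / real N"

lemma saw_mean_add_int: "saw_mean N x (t + of_int k) = saw_mean N x t"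
proof -
  have "saw (x n - (t + of_int k)) = saw (x n - t)" for n
    using saw_add_int[of "x n - (t + of_int k)" k] by simp
  then show ?thesis by (simp only: saw_mean_def)
qed

lemma abs_saw_le: "\<bar>saw t\<bar> \<le> 1 / 2"
  using frac_ge_0[of t] frac_lt_1[of t] by (simp only: saw_def abs_le_iff) linarith

lemma abs_saw_mean_le:
  assumes "N \<ge> 1"
  shows "\<bar>saw_mean N x t\<bar> \<le> 1 / 2"
proof -
  have "\<bar>\<Sum>n=1..N. saw (x n - t)\<bar> \<le> (\<Sum>n=1..N. 1 / 2)"
    by (rule order.trans[OF sum_abs sum_mono]) (rule abs_saw_le)
  then show ?thesis using assms by (simp add: saw_mean_def divide_simps)
qed

text \<open>Moving left by \<open>u\<close> lowers the linear part by \<open>u\<close>, while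
  crossing an integer only produces an upward jump.\<close>

lemma saw_diff_le:
  assumes "0 \<le> u"
  shows "saw t - u \<le> saw (t - u)"
  using floor_mono[of "t - u" t] assms by (simp add: saw_def frac_def)

lemma saw_mean_add_ge:
  assumes "N \<ge> 1" "0 \<le> u"
  shows "saw_mean N x t - u \<le> saw_mean N x (t + u)"
proof -
  have "(\<Sum>n=1..N. saw (x n - t) - u) \<le> (\<Sum>n=1..N. saw (x n - (t + u)))"
    using saw_diff_le[OF assms(2), of "x n - t" for n] by (intro sum_mono) (simp add: algebra_simps)
  then have "((\<Sum>n=1..N. saw (x n - t)) - real N * u) / real N \<le> saw_mean N x (t + u)"
    unfolding saw_mean_def by (intro divide_right_mono) (simp_all add: sum_subtractf)
  then show ?thesis
    using assms(1) by (simp add: saw_mean_def diff_divide_distrib)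
qed

text \<open>The indicator of \<open>[\<alpha>, \<beta>)\<close> is the difference of the indicators
  of \<open>frac t < \<beta>\<close> and \<open>frac t < \<alpha>\<close>, and each of these is a
  sawtooth plus a linear term. The value -1/2 of \<open>saw\<close> at integers makes this exact at
  the endpoints.\<close>

lemma count_frac_conv_saw_mean:
  assumes "N \<ge> 1" "0 \<le> \<alpha>" "\<alpha> < \<beta>" "\<beta> \<le> 1"
  shows "real (count_frac N x \<alpha> \<beta>) / real N - (\<beta> - \<alpha>) = saw_mean N x \<beta> - saw_mean N x \<alpha>"
proof -
  have *: "of_bool (\<alpha> \<le> frac t \<and> frac t < \<beta>) = saw (t - \<beta>) - saw (t - \<alpha>) + (\<beta> - \<alpha>)" for t
  proof -
    have t: "0 \<le> frac t" "frac t < 1" "t = frac t + of_int \<lfloor>t\<rfloor>"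
      by (auto simp: frac_lt_1) (simp add: frac_def)
    have "saw (t - \<gamma>) = frac t - \<gamma> - 1 / 2 + of_bool (frac t < \<gamma>)" if "0 \<le> \<gamma>" "\<gamma> \<le> 1" for \<gamma>
    proof -
      have "frac (t - \<gamma>) = frac t - \<gamma> + of_bool (frac t < \<gamma>)"
        unfolding frac_unique_iff
      proof (intro conjI)
        show "t - \<gamma> - (frac t - \<gamma> + of_bool (frac t < \<gamma>)) \<in> \<int>"
          by (simp add: frac_def)
        show "0 \<le> frac t - \<gamma> + of_bool (frac t < \<gamma>)" "frac t - \<gamma> + of_bool (frac t < \<gamma>) < 1"
          using that t(1,2) by (cases "frac t < \<gamma>"; simp; linarith)+
      qed
      then show ?thesis by (simp add: saw_def)
    qed
    from this[of \<alpha>] this[of \<beta>] show ?thesis using assms by (auto simp: of_bool_def)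
  qed
  have "real (count_frac N x \<alpha> \<beta>) = (\<Sum>n=1..N. of_bool (\<alpha> \<le> frac (x n) \<and> frac (x n) < \<beta>))"
    by (simp add: count_frac_def sum.If_cases of_bool_def Int_def)
  also have "\<dots> = (\<Sum>n=1..N. saw (x n - \<beta>)) - (\<Sum>n=1..N. saw (x n - \<alpha>)) + real N * (\<beta> - \<alpha>)"
    by (simp add: * sum.distrib sum_subtractf)
  finally show ?thesis
    using assms(1) by (simp add: saw_mean_def field_simps)
qed

section \<open>Exponential sums and the bound for the mean sawtooth\<close>

definition weyl :: "nat \<Rightarrow> (nat \<Rightarrow> real) \<Rightarrow> nat \<Rightarrow> real" where
  "weyl N x h = 1 / real N *
     cmod (\<Sum>n=1..N. exp (2 * complex_of_real pi * \<i> * of_nat h * complex_of_real (x n)))"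

lemma weyl_nonneg: "0 \<le> weyl N x h"
  by (simp add: weyl_def)

text \<open>The shift by \<open>t\<close> multiplies the exponential sum by a number of modulus 1,
  so the bound is uniform in \<open>t\<close>.\<close>

lemma abs_sin_mean_le:
  "\<bar>(\<Sum>n=1..N. sin (2 * pi * real h * (x n - t))) / real N\<bar> \<le> weyl N x h"
proof -
  have "(\<Sum>n=1..N. sin (2 * pi * real h * (x n - t)))
      = Im (cis (- (2 * pi * real h * t)) *
          (\<Sum>n=1..N. exp (2 * complex_of_real pi * \<i> * of_nat h * complex_of_real (x n))))"
    unfolding sum_distrib_left Im_sum
  proof (rule sum.cong)
    fix n
    have "exp (2 * complex_of_real pi * \<i> * of_nat h * complex_of_real (x n))
        = cis (2 * pi * real h * x n)"
      by (simp add: cis_conv_exp mult_ac)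
    then show "sin (2 * pi * real h * (x n - t)) = Im (cis (- (2 * pi * real h * t)) *
        exp (2 * complex_of_real pi * \<i> * of_nat h * complex_of_real (x n)))"
      by (simp only: cis_mult cis.sel) (simp add: algebra_simps)
  qed simp
  also have "\<bar>\<dots>\<bar> \<le> cmod (\<Sum>n=1..N. exp (2 * complex_of_real pi * \<i> * of_nat h * complex_of_real (x n)))"
    by (rule order.trans[OF abs_Im_le_cmod]) (simp add: norm_mult)
  finally show ?thesis
    by (simp add: weyl_def divide_right_mono abs_divide)
qed

lemma saw_mean_fejer_integral:
  assumes "H \<ge> 1"
  obtains I where "((\<lambda>y. saw_mean N x (t + y) * fejer H y) has_integral I) {0..1}"
    and "\<bar>I\<bar> \<le> (\<Sum>h=1..H. weyl N x h / (pi * real h))"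
proof
  define c where "c h = (1 - real h / real H) / (pi * real h)" for h
  define I where "I = (\<Sum>n=1..N. - (\<Sum>h=1..H. c h * sin (2 * pi * real h * (x n - t)))) / real N"
  have "((\<lambda>y. (\<Sum>n=1..N. saw (x n - t - y) * fejer H y) / real N) has_integral I) {0..1}"
    unfolding I_def using saw_fejer_integral[of "x n - t" H for n]
    by (intro has_integral_divide has_integral_sum) (simp_all add: c_def)
  then show "((\<lambda>y. saw_mean N x (t + y) * fejer H y) has_integral I) {0..1}"
    by (simp add: saw_mean_def diff_diff_eq flip: sum_distrib_right)
  have "I = - (\<Sum>n=1..N. \<Sum>h=1..H. c h * sin (2 * pi * real h * (x n - t))) / real N"
    by (simp add: I_def sum_negf)
  also have "\<dots> = - (\<Sum>h=1..H. \<Sum>n=1..N. c h * sin (2 * pi * real h * (x n - t))) / real N"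
    by (subst sum.swap) simp
  also have "\<dots> = - (\<Sum>h=1..H. c h * ((\<Sum>n=1..N. sin (2 * pi * real h * (x n - t))) / real N))"
    by (simp add: sum_distrib_left sum_divide_distrib)
  finally have "\<bar>I\<bar> = \<bar>\<Sum>h=1..H. c h * ((\<Sum>n=1..N. sin (2 * pi * real h * (x n - t))) / real N)\<bar>"
    by simp
  also have "\<dots> \<le> (\<Sum>h=1..H. \<bar>c h * ((\<Sum>n=1..N. sin (2 * pi * real h * (x n - t))) / real N)\<bar>)"
    by (rule sum_abs)
  also have "\<dots> \<le> (\<Sum>h=1..H. weyl N x h / (pi * real h))"
  proof (rule sum_mono)
    fix h assume h: "h \<in> {1..H}"
    have "\<bar>c h\<bar> \<le> 1 / (pi * real h)"
      unfolding c_def abs_divide using h assms by (intro frac_le) (auto simp: field_simps)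
    then have "\<bar>c h * ((\<Sum>n=1..N. sin (2 * pi * real h * (x n - t))) / real N)\<bar>
        \<le> 1 / (pi * real h) * weyl N x h"
      unfolding abs_mult by (rule mult_mono[OF _ abs_sin_mean_le]) auto
    then show "\<bar>c h * ((\<Sum>n=1..N. sin (2 * pi * real h * (x n - t))) / real N)\<bar>
        \<le> weyl N x h / (pi * real h)"
      by simp
  qed
  finally show "\<bar>I\<bar> \<le> (\<Sum>h=1..H. weyl N x h / (pi * real h))" .
qed

text \<open>
  The a priori bound \<open>S\<close> is needed only on the tail of the kernel, so it reappears on the right with
  a factor that is small for \<open>\<delta> = 1/H\<close>; taking \<open>S\<close> to be the supremum absorbs it on the left.
\<close>

lemma abs_saw_mean_bootstrap:
  assumes N: "N \<ge> 1" and H: "H \<ge> 1" and d: "0 < \<delta>" "\<delta> \<le> 1 / 2"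
    and S: "\<And>t. \<bar>saw_mean N x t\<bar> \<le> S"
  shows "\<bar>saw_mean N x t\<bar> \<le> (\<Sum>h=1..H. weyl N x h / (pi * real h)) + 2 * \<delta>
    + 2 * S * (2 * cot (pi * \<delta>) / pi / real H)"
    (is "_ \<le> ?B + _ + ?\<tau>")
proof -
  have S0: "0 \<le> S" using S[of 0] by linarith
  have t: "0 \<le> cot (pi * \<delta>)"
    unfolding cot_def using d pi_gt_zero mult_left_mono[OF d(2), of pi]
    by (intro divide_nonneg_nonneg sin_ge_zero cos_ge_zero) (auto intro: order.trans[of _ 0])
  then have \<tau>: "0 \<le> ?\<tau>" using S0 by simp
  have B: "0 \<le> ?B" by (intro sum_nonneg divide_nonneg_nonneg weyl_nonneg) simp
  have bd: "- S \<le> saw_mean N x s" "- S \<le> - saw_mean N x s" for s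
    using S[of s] by linarith+
  have per: "saw_mean N x (s + y) = saw_mean N x (s + (y - 1))" for s y
    using saw_mean_add_int[of N x "s + (y - 1)" 1] by simp
  have "saw_mean N x t \<le> ?B + 2 * \<delta> + ?\<tau>"
  \<comment> \<open>In the other case the bound is immediate, its other two terms being
    nonnegative.\<close>
  proof (cases "0 \<le> saw_mean N x t - 2 * \<delta>")
    case True
    \<comment> \<open>The kernel is centred at \<open>t + \<delta>\<close>, so that the window of
      radius \<open>\<delta>\<close> lies to the right of \<open>t\<close>, where the mean has
      dropped by at most \<open>2 * \<delta>\<close>.\<close>
    obtain I where I: "((\<lambda>y. saw_mean N x (t + \<delta> + y) * fejer H y) has_integral I) {0..1}" "\<bar>I\<bar> \<le> ?B"
      using saw_mean_fejer_integral[OF H] .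
    have near: "saw_mean N x t - 2 * \<delta> \<le> saw_mean N x (t + \<delta> + y)" if "- \<delta> \<le> y" "y \<le> \<delta>" for y
      using saw_mean_add_ge[OF N, of "\<delta> + y" x t] that by (simp add: add.assoc)
    \<comment> \<open>By periodicity the left half of the window is seen at the right end of
      \<open>[0, 1]\<close>.\<close>
    have far: "saw_mean N x t - 2 * \<delta> \<le> saw_mean N x (t + \<delta> + y)" if "1 - \<delta> \<le> y" "y \<le> 1" for y
      using near[of "y - 1"] that d by (simp only: per[of "t + \<delta>" y])
    have "saw_mean N x t - 2 * \<delta> - ?\<tau> \<le> I"
    proof (rule fejer_average_ge[OF H d I(1) bd(1) _ _ far])
      show "saw_mean N x t - 2 * \<delta> \<le> S" "0 \<le> saw_mean N x t - 2 * \<delta> + S"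
        using S[of t] True S0 d by linarith+
      fix y assume "0 \<le> y" "y \<le> \<delta>"
      then show "saw_mean N x t - 2 * \<delta> \<le> saw_mean N x (t + \<delta> + y)"
        using d by (intro near) auto
    qed
    with I(2) show ?thesis by linarith
  qed (use \<tau> B in linarith)
  moreover have "- saw_mean N x t \<le> ?B + 2 * \<delta> + ?\<tau>"
  proof (cases "0 \<le> - saw_mean N x t - 2 * \<delta>")
    case True
    \<comment> \<open>A negative value persists to the left of \<open>t\<close> instead, hence the
      centre \<open>t - \<delta>\<close>.\<close>
    obtain I where I: "((\<lambda>y. saw_mean N x (t - \<delta> + y) * fejer H y) has_integral I) {0..1}" "\<bar>I\<bar> \<le> ?B"
      using saw_mean_fejer_integral[OF H] .
    have I': "((\<lambda>y. - saw_mean N x (t - \<delta> + y) * fejer H y) has_integral - I) {0..1}"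
      using has_integral_neg[OF I(1)] by simp
    have near: "- saw_mean N x t - 2 * \<delta> \<le> - saw_mean N x (t - \<delta> + y)" if "- \<delta> \<le> y" "y \<le> \<delta>" for y
      using saw_mean_add_ge[OF N, of "\<delta> - y" x "t - \<delta> + y"] that by (simp add: algebra_simps)
    have far: "- saw_mean N x t - 2 * \<delta> \<le> - saw_mean N x (t - \<delta> + y)" if "1 - \<delta> \<le> y" "y \<le> 1" for y
      using near[of "y - 1"] that d by (simp only: per[of "t - \<delta>" y])
    have "- saw_mean N x t - 2 * \<delta> - ?\<tau> \<le> - I"
    proof (rule fejer_average_ge[OF H d I' bd(2) _ _ far])
      show "- saw_mean N x t - 2 * \<delta> \<le> S" "0 \<le> - saw_mean N x t - 2 * \<delta> + S"
        using S[of t] True S0 d by linarith+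
      fix y assume "0 \<le> y" "y \<le> \<delta>"
      then show "- saw_mean N x t - 2 * \<delta> \<le> - saw_mean N x (t - \<delta> + y)"
        using d by (intro near) auto
    qed
    with I(2) show ?thesis by linarith
  qed (use \<tau> B in linarith)
  ultimately show ?thesis by (simp add: abs_le_iff)
qed

section \<open>The Erdos-Turan inequality\<close>

lemma cot_le_inverse:
  fixes z :: real
  assumes "0 < z" "z < pi / 2"
  shows "cot z \<le> 1 / z"
proof -
  \<comment> \<open>The derivative \<open>u * sin u\<close> is nonnegative; the claim amounts to
    \<open>z * cos z \<le> sin z\<close>.\<close>
  have "sin z - z * cos z \<ge> sin 0 - 0 * cos 0"
  proof (rule DERIV_nonneg_imp_nondecreasing[where f = "\<lambda>z. sin z - z * cos z"])
    fix u :: real assume "0 \<le> u" "u \<le> z"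
    then show "\<exists>y. ((\<lambda>z. sin z - z * cos z) has_real_derivative y) (at u) \<and> 0 \<le> y"
      using assms by (intro exI[of _ "u * sin u"] conjI mult_nonneg_nonneg sin_ge_zero)
        (auto intro!: derivative_eq_intros)
  qed (use assms in simp)
  moreover have "0 < sin z" using assms by (intro sin_gt_zero) auto
  ultimately show ?thesis using assms by (simp add: cot_def field_simps)
qed

lemma discrepancy_leI:
  assumes "\<And>\<alpha> \<beta>. 0 \<le> \<alpha> \<Longrightarrow> \<alpha> < \<beta> \<Longrightarrow> \<beta> \<le> 1 \<Longrightarrow>
    \<bar>real (count_frac N x \<alpha> \<beta>) / real N - (\<beta> - \<alpha>)\<bar> \<le> B"
  shows "discrepancy N x \<le> B"
  unfolding discrepancy_def
proof (rule cSUP_least)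
  have "(0, 1) \<in> {(\<alpha>, \<beta>). 0 \<le> \<alpha> \<and> \<alpha> < \<beta> \<and> \<beta> \<le> (1::real)}" by simp
  then show "{(\<alpha>, \<beta>). 0 \<le> \<alpha> \<and> \<alpha> < \<beta> \<and> \<beta> \<le> (1::real)} \<noteq> {}" by blast
qed (use assms in auto)

lemma erdos_turan:
  assumes N: "N \<ge> 1" and H: "H \<ge> 1"
  shows "discrepancy N x \<le> 8 / real H + 4 * (\<Sum>h=1..H. weyl N x h / real h)"
proof -
  define B where "B = (\<Sum>h=1..H. weyl N x h / (pi * real h))"
  define S where "S = (SUP t. \<bar>saw_mean N x t\<bar>)"
  have bdd: "bdd_above (range (\<lambda>t. \<bar>saw_mean N x t\<bar>))"
    using abs_saw_mean_le[OF N] by (intro bdd_aboveI2)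
  then have le_S: "\<bar>saw_mean N x t\<bar> \<le> S" for t
    unfolding S_def by (intro cSUP_upper) auto
  have B0: "0 \<le> B" unfolding B_def by (intro sum_nonneg divide_nonneg_nonneg weyl_nonneg) simp
  have S0: "0 \<le> S" using le_S[of 0] by linarith
  have "S \<le> 2 * B + 4 / real H"
  \<comment> \<open>For small \<open>H\<close> the trivial bound 1/2 is enough; otherwise
    \<open>1/H\<close> is below 1/2, as the cotangent estimate needs.\<close>
  proof (cases "H \<le> 2")
    case True
    have "S \<le> 1 / 2" unfolding S_def using abs_saw_mean_le[OF N] by (intro cSUP_least) auto
    also have "\<dots> \<le> 4 / real H" using True H by (simp add: divide_simps)
    finally show ?thesis using B0 by simp
  next
    case False
    define \<delta> where "\<delta> = 1 / real H"
    have d: "0 < \<delta>" "\<delta> < 1 / 2" using False by (auto simp: \<delta>_def divide_simps)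
    have "2 * cot (pi * \<delta>) / pi / real H \<le> 2 * (1 / (pi * \<delta>)) / pi / real H"
      using cot_le_inverse[of "pi * \<delta>"] d
      by (intro divide_right_mono mult_left_mono) (auto simp: field_simps)
    also have "\<dots> = 2 / (pi * pi)" using False by (simp add: \<delta>_def)
    also have "\<dots> \<le> 2 / (3 * 3)"
      using pi_gt3 by (intro divide_left_mono mult_mono) auto
    finally have "2 * S * (2 * cot (pi * \<delta>) / pi / real H) \<le> 2 * S * (2 / (3 * 3))"
      using S0 by (intro mult_left_mono) auto
    moreover have "S \<le> B + 2 * \<delta> + 2 * S * (2 * cot (pi * \<delta>) / pi / real H)"
      unfolding B_def using abs_saw_mean_bootstrap[OF N H d(1) _ le_S] d(2)
      by (subst S_def) (auto intro!: cSUP_least)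
    \<comment> \<open>The tail costs at most \<open>4/9 * S\<close>; moving it to the left leaves
      \<open>5/9 * S \<le> B + 2 * \<delta>\<close>.\<close>
    ultimately have "S \<le> 2 * B + 4 * \<delta>" using d(1) B0 by linarith
    then show ?thesis by (simp add: \<delta>_def)
  qed
  moreover have "B \<le> (\<Sum>h=1..H. weyl N x h / real h)"
    unfolding B_def using pi_gt3
    by (intro sum_mono divide_left_mono weyl_nonneg) auto
  moreover have "discrepancy N x \<le> 2 * S"
  proof (rule discrepancy_leI)
    fix \<alpha> \<beta> :: real
    assume p: "0 \<le> \<alpha>" "\<alpha> < \<beta>" "\<beta> \<le> 1"
    show "\<bar>real (count_frac N x \<alpha> \<beta>) / real N - (\<beta> - \<alpha>)\<bar> \<le> 2 * S"
      unfolding count_frac_conv_saw_mean[OF N p]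
      using le_S[of \<alpha>] le_S[of \<beta>] by linarith
  qed
  ultimately show ?thesis by simp
qed

lemma discrepancy_le_1:
  assumes "N \<ge> 1"
  shows "discrepancy N x \<le> 1"
proof (rule discrepancy_leI)
  fix \<alpha> \<beta> :: real
  assume p: "0 \<le> \<alpha>" "\<alpha> < \<beta>" "\<beta> \<le> 1"
  show "\<bar>real (count_frac N x \<alpha> \<beta>) / real N - (\<beta> - \<alpha>)\<bar> \<le> 1"
    unfolding count_frac_conv_saw_mean[OF assms p]
    using abs_saw_mean_le[OF assms, of x \<alpha>] abs_saw_mean_le[OF assms, of x \<beta>] by linarith
qed

section \<open>From the Erdos-Turan sum to the weighted series\<close>

lemma threshold_le:
  fixes a b c :: real
  assumes ab: "2 * b \<le> a" "0 \<le> b" "b < 2" and h: "1 \<le> h" "h \<le> H" and c: "0 \<le> c"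
  shows "c / real h \<le> 1 / (real H)\<^sup>2
    + real h powr (- ((2 + a - 2 * b) / (2 - b))) * c powr (2 / (2 - b)) * real H powr (a / (2 - b))"
proof (cases "c \<le> real h / (real H)\<^sup>2")
  case True
  then have "c / real h \<le> real h / (real H)\<^sup>2 / real h" by (rule divide_right_mono) simp
  also have "\<dots> = 1 / (real H)\<^sup>2" using h by simp
  finally show ?thesis by (simp add: add_increasing2)
next
  case False
  \<comment> \<open>In these parameters the exponents are \<open>1 + q\<close> for \<open>c\<close>,
    \<open>- (1 + r + q)\<close> for \<open>h\<close> and \<open>r + 2 * q\<close> for
    \<open>H\<close>. The assumption \<open>2 * b \<le> a\<close> makes \<open>r\<close>
    nonnegative.\<close>
  define q where "q = b / (2 - b)"
  define r where "r = (a - 2 * b) / (2 - b)"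
  have qr: "0 \<le> q" "0 \<le> r" using ab by (auto simp: q_def r_def)
  have e: "2 / (2 - b) = 1 + q" "(2 + a - 2 * b) / (2 - b) = 1 + r + q" "a / (2 - b) = r + 2 * q"
    using ab by (simp_all add: q_def r_def divide_simps)
  have H: "0 < real h" "0 < real H" using h by auto
  have c0: "0 < c" using False H by (auto simp: not_le intro: le_less_trans[rotated])
  \<comment> \<open>The factor inserted is at least 1 because \<open>h \<le> H\<close>; below,
    \<open>h / H^2 < c\<close> trades a power of \<open>h / H^2\<close> for one of
    \<open>c\<close>.\<close>
  have "c / real h \<le> c / real h * (real H / real h) powr r"
    using h qr ge_one_powr_ge_zero[of "real H / real h" r] H
      mult_left_mono[of 1 "(real H / real h) powr r" "c / real h"] c by simp
  also have "\<dots> = real h powr (- (1 + r + q)) * (c * (real h / (real H)\<^sup>2) powr q) * real H powr (r + 2 * q)"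
  proof -
    have A: "real h powr (- (1 + r + q)) = inverse (real h * real h powr r * real h powr q)"
      using H by (simp only: powr_minus powr_add powr_one)
    have "(real H)\<^sup>2 powr q = (real H powr 2) powr q" using H by simp
    then have B: "(real h / (real H)\<^sup>2) powr q = real h powr q / real H powr (2 * q)"
      using H by (simp only: powr_divide powr_powr)
    show ?thesis
      unfolding A B unfolding powr_add powr_divide using H by (simp add: divide_simps)
  qed
  also have "\<dots> \<le> real h powr (- (1 + r + q)) * c powr (1 + q) * real H powr (r + 2 * q)"
  proof -
    have "(real h / (real H)\<^sup>2) powr q \<le> c powr q"
      using less_imp_le[OF False[unfolded not_le]] qr by (intro powr_mono2) auto
    then have "c * (real h / (real H)\<^sup>2) powr q \<le> c powr (1 + q)"
      using c0 by (simp add: powr_add)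
    then show ?thesis by (intro mult_right_mono mult_left_mono) auto
  qed
  finally show ?thesis unfolding e by (simp add: add_increasing)
qed

text \<open>The condition on \<open>T\<close> bounds the contribution of the large terms by
  \<open>1/H\<close>, the same as for the small ones. The total is
  \<open>8/H + 4 * (1/H + 1/H)\<close>.\<close>

lemma discrepancy_le_weighted:
  fixes a b T :: real
  assumes ab: "2 * b \<le> a" "0 \<le> b" "b < 2" and N: "N \<ge> 1" and H: "H \<ge> 1"
    and T: "(\<Sum>h=1..H. real h powr (- ((2 + a - 2 * b) / (2 - b))) * weyl N x h powr (2 / (2 - b))) \<le> T"
    and TH: "T * real H powr (1 + a / (2 - b)) \<le> 1"
  shows "discrepancy N x \<le> 16 / real H"
proof -
  have "(\<Sum>h=1..H. weyl N x h / real h) \<le> (\<Sum>h=1..H. 1 / (real H)\<^sup>2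
    + real h powr (- ((2 + a - 2 * b) / (2 - b))) * weyl N x h powr (2 / (2 - b)) * real H powr (a / (2 - b)))"
    using threshold_le[OF ab _ _ weyl_nonneg] by (intro sum_mono) auto
  also have "\<dots> = 1 / real H + (\<Sum>h=1..H. real h powr (- ((2 + a - 2 * b) / (2 - b)))
      * weyl N x h powr (2 / (2 - b))) * real H powr (a / (2 - b))"
    using H by (simp add: sum.distrib sum_distrib_right power2_eq_square)
  also have "\<dots> \<le> 1 / real H + T * real H powr (a / (2 - b))"
    using T by (intro add_left_mono mult_right_mono) auto
  also have "T * real H powr (a / (2 - b)) \<le> 1 / real H"
    using TH H by (simp add: powr_add field_simps)
  finally show ?thesis
    using erdos_turan[OF N H, of x] by simp
qed

lemma discrepancy_le_weighted_powr:
  fixes a b T :: real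
  assumes ab: "2 * b \<le> a" "0 \<le> b" "b < 2" and N: "N \<ge> 1" and T0: "0 \<le> T"
    and T: "\<And>H. (\<Sum>h=1..H. real h powr (- ((2 + a - 2 * b) / (2 - b)))
      * weyl N x h powr (2 / (2 - b))) \<le> T"
  shows "discrepancy N x \<le> 32 * T powr ((2 - b) / (2 + a - b))"
proof -
  define \<theta> where "\<theta> = (2 - b) / (2 + a - b)"
  have \<theta>: "0 < \<theta>" "1 + a / (2 - b) = 1 / \<theta>"
    using ab by (auto simp: \<theta>_def field_simps)
  note bound = discrepancy_le_weighted[OF ab N _ T, unfolded \<theta>(2)]
  consider "T = 0" | "0 < T" "T < 1" | "1 \<le> T" using T0 by linarith
  then have "discrepancy N x \<le> 32 * T powr \<theta>"
  proof cases
    \<comment> \<open>Every order \<open>H\<close> is admissible, so \<open>H\<close> may tend to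
      infinity.\<close>
    case 1
    have "discrepancy N x \<le> 0"
    proof (rule LIMSEQ_le_const)
      show "(\<lambda>H. 16 / real H) \<longlonglongrightarrow> 0" by (rule lim_const_over_n)
    qed (use bound 1 in auto)
    then show ?thesis using 1 by simp
  next
    case 2
    \<comment> \<open>This \<open>R\<close> solves \<open>T * R powr (1 / \<theta>) = 1\<close>.
      Rounding it down to an integer loses at most a factor 2, which turns 16 into 32.\<close>
    define R where "R = T powr - \<theta>"
    define H where "H = nat \<lfloor>R\<rfloor>"
    have R: "1 \<le> R" using 2 \<theta> by (simp add: R_def powr_minus one_le_inverse powr_le1)
    then have "1 \<le> \<lfloor>R\<rfloor>" "real H = of_int \<lfloor>R\<rfloor>" by (simp_all add: H_def)
    then have H: "1 \<le> H" "real H \<le> R" "R \<le> 2 * real H" by linarith+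
    have "T * real H powr (1 / \<theta>) \<le> T * R powr (1 / \<theta>)"
      using 2 \<theta> H by (intro mult_left_mono powr_mono2) auto
    also have "\<dots> = 1" using 2 \<theta> by (simp add: R_def powr_powr)
    finally have "discrepancy N x \<le> 16 / real H" by (rule bound[OF H(1)])
    also have "\<dots> \<le> 32 / R" using H R by (simp add: divide_simps)
    also have "\<dots> = 32 * T powr \<theta>" using 2 by (simp add: R_def powr_minus divide_simps)
    finally show ?thesis .
  next
    case 3
    then have "1 \<le> T powr \<theta>" using \<theta> by (simp add: ge_one_powr_ge_zero)
    then show ?thesis using discrepancy_le_1[OF N, of x] by linarith
  qed
  then show ?thesis unfolding \<theta>_def .
qed

text \<open>The constant 32 serves all admissible \<open>a\<close> and \<open>b\<close>. A divergent
  series makes the right-hand side infinite; a convergent one has a real sum bounding all partial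
  sums.\<close>

theorem theorem1:
  fixes a b :: real
  assumes "a \<ge> 2 * b" and "0 \<le> b" and "b < 2"
  shows "\<exists>C::real. C > 0 \<and>
    (\<forall>(x :: nat \<Rightarrow> real) (N :: nat). N \<ge> 1 \<longrightarrow>
      ennreal (discrepancy N x) \<le>
        ennreal C *
        ennreal_powr
          (\<Sum>h. ennreal
             (real (Suc h) powr (- ((2 + a - 2 * b) / (2 - b))) *
              (1 / real N *
               cmod (\<Sum>n = 1..N. exp (2 * complex_of_real pi * \<i> * of_nat (Suc h) * complex_of_real (x n))))
                powr (2 / (2 - b))))
          ((2 - b) / (2 + a - b)))"
proof (rule exI[of _ 32], intro conjI allI impI)
  fix x :: "nat \<Rightarrow> real" and N :: nat
  assume N: "N \<ge> 1"
  define f where "f h = real h powr (- ((2 + a - 2 * b) / (2 - b))) * weyl N x h powr (2 / (2 - b))" for h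
  have f0: "0 \<le> f h" for h by (simp add: f_def)
  define T where "T = (\<Sum>h. ennreal (f (Suc h)))"
  have "ennreal (discrepancy N x) \<le> ennreal 32 * ennreal_powr T ((2 - b) / (2 + a - b))"
  proof (cases "T = \<infinity>")
    case True
    then show ?thesis by (simp add: ennreal_powr_def ennreal_mult_top)
  next
    case False
    then have T: "ennreal (enn2real T) = T" by (simp add: less_top)
    have "(\<Sum>h=1..H. f h) \<le> enn2real T" for H
    proof -
      \<comment> \<open>The series is indexed from 0 and the sums of the estimate from 1, hence the
        shift.\<close>
      have "ennreal (\<Sum>h=1..H. f h) = (\<Sum>h<H. ennreal (f (Suc h)))"
        by (simp add: f0 sum_ennreal sum.atLeast1_atMost_eq)
      also have "\<dots> \<le> T" unfolding T_def by (rule sum_le_suminf) auto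
      finally have "ennreal (\<Sum>h=1..H. f h) \<le> ennreal (enn2real T)" unfolding T .
      then show ?thesis by (simp only: ennreal_le_iff enn2real_nonneg)
    qed
    then have "discrepancy N x \<le> 32 * enn2real T powr ((2 - b) / (2 + a - b))"
      unfolding f_def using assms N by (intro discrepancy_le_weighted_powr) auto
    then have "ennreal (discrepancy N x) \<le> ennreal 32 * ennreal (enn2real T powr ((2 - b) / (2 + a - b)))"
      by (subst ennreal_mult'[symmetric]) (simp_all only: ennreal_leI zero_le_numeral)
    then show ?thesis
      using False by (simp add: ennreal_powr_def)
  qed
  then show "ennreal (discrepancy N x) \<le>
        ennreal 32 *
        ennreal_powr
          (\<Sum>h. ennreal
             (real (Suc h) powr (- ((2 + a - 2 * b) / (2 - b))) *
              (1 / real N *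
               cmod (\<Sum>n = 1..N. exp (2 * complex_of_real pi * \<i> * of_nat (Suc h) * complex_of_real (x n))))
                powr (2 / (2 - b))))
          ((2 - b) / (2 + a - b))"
    unfolding T_def f_def weyl_def .
qed (rule zero_less_numeral)

end
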